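(* Take $\mathcal I=\mathcal X$, i.e. $\mathcal I=\{x\in\mathbb R^n : Gx\le g\}$ with $G=F$ and $g=f$, let $N\ge 1$ be an integer, and let $\mathrm{MPC}_N(x)$ denote the robust model predictive control optimization problem with current state $x$ and target polytope $\mathcal I$ (as defined in the context). If $\mathrm{MPC}_N(v)$ is feasible for every vertex $v$ of $\mathcal I$, then $\mathcal I$ is feasible robust controlled invariant for the uncertain system $x_{k+1}=Ax_k+Bu_k+Dp_k$ with constraints $x_k\in\mathcal X$, $u_k\in\mathcal U$, $p_k\in\mathcal P(x_k,u_k)$. Moreover, when $N=1$ the condition is also necessary: if $\mathcal I$ is feasible robust controlled invariant, then $\mathrm{MPC}_1(v)$ is feasible for every vertex $v$ of $\mathcal I$.
   Context: System. $A\in\mathbb R^{n\times n}$, $B\in\mathbb R^{n\times m}$, $D\in\mathbb R^{n\times d}$ are constant matrices, and $x_{k+1}=Ax_k+Bu_k+Dp_k$ for $k=0,1,2,\dots$, where $x_k\in\mathbb R^n$ is the state, $u_k\in\mathbb R^m$ the input and $p_k\in\mathbb R^d$ the uncertainty. Constraints. $\mathcal X=\{x\in\mathbb R^n : Fx\le f\}$ and $\mathcal U=\{u\in\mathbb R^m : Hu\le h\}$ are compact convex polytopes. All vector inequalities are componentwise. Uncertainty set. For $x\in\mathbb R^n$, $u\in\mathbb R^m$, $$\mathcal P(x,u)=\Big\{Ww+\sum_{i=1}^{n_q}L_iq_i\in\mathbb R^d : Rw\le r,\ \|q_i\|_{p_{q,i}}\le\phi_i\big(\|F_{x,i}x\|_{p_{x,i}},\|F_{u,i}u\|_{p_{u,i}}\big),\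 i=1,\dots,n_q\Big\},$$ where $W,R,r,L_i,F_{x,i},F_{u,i}$ are fixed matrices/vectors of compatible dimensions, $p_{q,i},p_{x,i},p_{u,i}\in[1,\infty]$ are norm indices, and each $\phi_i:\mathbb R_+\times\mathbb R_+\to\mathbb R_+$ is convex and non-decreasing (in each argument). It is assumed that $\mathcal P(x,u)$ is (nonempty and) compact for all $x\in\mathcal X$, $u\in\mathcal U$. Write $\mathcal W=\{Ww : Rw\le r\}$. Feasible robust controlled invariance (fRCI). A compact convex set $\mathcal I$ is feasible robust controlled invariant for this system and these constraints if $$\mathcal I=\{x\in\mathcal X : \exists u\in\mathcal U \text{ such that } Ax+Bu+Dp\in\mathcal I\ \text{ for all } p\in\mathcal P(x,u)\}.$$ Notation. $G$ has $n_g$ rows and $G_j^{\mathsf T}$ is its $j$-th row. For a set $\mathcal S$ and a vector $v$, $\sigma_{\mathcal S}(v)=\max_{z\in\mathcal S}v^{\mathsf T}z$, and $M\mathcal S=\{Mz : z\in\mathcal S\}$. For $t\in\{1,\dots,N\}$ and $i\in\{0,\dots,t-1\}$, $B^A_i=A^{t-1-i}B$ and $D^A_i=A^{t-1-i}D$ (dependence on $t$ suppressed). $q_{q,l}$ is the dual exponent of $p_{q,l}$: $1/q_{q,l}+1/p_{q,l}=1$. Given a current state $x_k$ and inputs $u_k,\dots,u_{k+N-1}$, the nominal states are $\bar x_k=x_k$ and $\bar x_{k+t}=A^tx_k+\sum_{i=0}^{t-1}B^A_iu_{k+i}$ for $t=1,\dots,N$. Optimization problem. $\mathrm{MPC}_N(x)$,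 with $x_k=x$, is: minimize $J(\bar x_{k+1},\dots,\bar x_{k+N},u_k,\dots,u_{k+N-1})$ over $u_k,\dots,u_{k+N-1}$, where $J:(\mathbb R^n)^N\times(\mathbb R^m)^N\to\mathbb R$ is a given convex function, subject to $u_{k+i}\in\mathcal U$ for $i=0,\dots,N-1$ and, for all $j=1,\dots,n_g$ and $t=1,\dots,N$, $$G_j^{\mathsf T}\bar x_{k+t}+\sum_{i=0}^{t-1}\sigma_{D^A_i\mathcal W}(G_j)+\sum_{i=0}^{t-1}\sum_{l=1}^{n_q}\|G_j^{\mathsf T}D^A_iL_l\|_{q_{q,l}}\,\phi_l\big(\|F_{x,l}\bar x_{k+i}\|_{p_{x,l}},\|F_{u,l}u_{k+i}\|_{p_{u,l}}\big)\le g_j .$$ The problem is feasible if its constraint set is nonempty. *)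

theory Defs
  imports "HOL-Analysis.Analysis"
begin

section \<open>Matrix powers and norms\<close>

text \<open>The power operation of the type class on \<^typ>\<open>real^'n^'n\<close> is entrywise, hence the separate
  definition.\<close>

definition mpow :: "real^'n^'n \<Rightarrow> nat \<Rightarrow> real^'n^'n" where
  "mpow A k = (((**) A) ^^ k) (mat 1)"

text \<open>
  Vectors of the spaces in which the norms are taken are lists, since the dimension of these spaces
  depends on the index of the term. The value is only meaningful for exponents in \<open>[1, \<infinity>]\<close>.
\<close>

definition pnorm :: "ennreal \<Rightarrow> real list \<Rightarrow> real" where
  "pnorm p v =
    (if p = \<infinity> then Max (insert 0 (abs ` set v))
     else (\<Sum>a\<leftarrow>v. \<bar>a\<bar> powr enn2real p) powr (1 / enn2real p))"

text \<open>The solution \<open>q\<close> of \<open>1 / q + 1 / p = 1\<close>; in \<^typ>\<open>ennreal\<close>, \<open>1 / 0 = \<infinity>\<close> and \<open>1 / \<infinity> = 0\<close>.\<close>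

definition dual_exponent :: "ennreal \<Rightarrow> ennreal" where
  "dual_exponent p = 1 / (1 - 1 / p)"

lemma dual_exponent:
  assumes "1 \<le> p"
  shows "1 / dual_exponent p + 1 / p = 1"
proof -
  have "1 / p \<le> 1"
  proof (cases p)
    case (real r)
    then have "1 \<le> r" using assms by (simp add: ennreal_1[symmetric] del: ennreal_1)
    then have "1 / p = ennreal (1 / r)"
      using real divide_ennreal[of 1 r] by simp
    then show ?thesis using \<open>1 \<le> r\<close> by simp
  qed simp
  then show ?thesis
    unfolding dual_exponent_def one_divide_one_divide_ennreal
    by (rule diff_add_cancel_ennreal)
qed

definition support_fun :: "(real^'n) set \<Rightarrow> real^'n \<Rightarrow> real" where
  "support_fun S v = (SUP z\<in>S. v \<bullet> z)"


section \<open>Uncertain constrained systems\<close>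

text \<open>
  The matrices \<open>L\<^sub>i\<close> are given by the list of their columns, \<open>F\<^sub>x\<^sub>,\<^sub>i\<close> and \<open>F\<^sub>u\<^sub>,\<^sub>i\<close> by the list of their
  rows; the lengths of these lists may depend on \<open>i\<close>. The terms are numbered from \<open>0\<close> to \<open>nq - 1\<close>.
\<close>

record ('n::finite, 'm::finite, 'd::finite, 'w::finite, 'r::finite, 'f::finite, 'h::finite) ucs =
  Amat :: "real^'n^'n"
  Bmat :: "real^'m^'n"
  Dmat :: "real^'d^'n"
  Fmat :: "real^'n^'f"
  fvec :: "real^'f"
  Hmat :: "real^'m^'h"
  hvec :: "real^'h"
  Wmat :: "real^'w^'d"
  Rmat :: "real^'w^'r"
  rvec :: "real^'r"
  nq :: nat
  Lcols :: "nat \<Rightarrow> (real^'d) list"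
  Fxrows :: "nat \<Rightarrow> (real^'n) list"
  Furows :: "nat \<Rightarrow> (real^'m) list"
  pq :: "nat \<Rightarrow> ennreal"
  px :: "nat \<Rightarrow> ennreal"
  pu :: "nat \<Rightarrow> ennreal"
  phi :: "nat \<Rightarrow> real \<Rightarrow> real \<Rightarrow> real"

definition polyh :: "real^'n^'g \<Rightarrow> real^'g \<Rightarrow> (real^'n) set" where
  "polyh G g = {x. G *v x \<le> g}"

definition state_set :: "('n::finite,'m::finite,'d::finite,'w::finite,'r::finite,'f::finite,'h::finite) ucs
    \<Rightarrow> (real^'n) set" where
  "state_set S = polyh (Fmat S) (fvec S)"

definition input_set :: "('n::finite,'m::finite,'d::finite,'w::finite,'r::finite,'f::finite,'h::finite) ucs
    \<Rightarrow> (real^'m) set" where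
  "input_set S = polyh (Hmat S) (hvec S)"

definition W_set :: "('n::finite,'m::finite,'d::finite,'w::finite,'r::finite,'f::finite,'h::finite) ucs
    \<Rightarrow> (real^'d) set" where
  "W_set S = {Wmat S *v w | w. Rmat S *v w \<le> rvec S}"

text \<open>The product of a matrix, given by its columns or by its rows, with a vector.\<close>

definition cols_mult :: "(real^'d) list \<Rightarrow> real list \<Rightarrow> real^'d" where
  "cols_mult cs q = sum_list (map2 (\<lambda>a c. a *\<^sub>R c) q cs)"

definition rows_mult :: "(real^'n) list \<Rightarrow> real^'n \<Rightarrow> real list" where
  "rows_mult rs x = map (\<lambda>r. r \<bullet> x) rs"

definition gain :: "('n::finite,'m::finite,'d::finite,'w::finite,'r::finite,'f::finite,'h::finite) ucs
    \<Rightarrow> nat \<Rightarrow> real^'n \<Rightarrow> real^'m \<Rightarrow> real" where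
  "gain S i x u = phi S i (pnorm (px S i) (rows_mult (Fxrows S i) x))
                          (pnorm (pu S i) (rows_mult (Furows S i) u))"

definition P_set :: "('n::finite,'m::finite,'d::finite,'w::finite,'r::finite,'f::finite,'h::finite) ucs
    \<Rightarrow> real^'n \<Rightarrow> real^'m \<Rightarrow> (real^'d) set" where
  "P_set S x u = {Wmat S *v w + (\<Sum>i<nq S. cols_mult (Lcols S i) (q i)) | w q.
      Rmat S *v w \<le> rvec S \<and>
      (\<forall>i<nq S. length (q i) = length (Lcols S i) \<and> pnorm (pq S i) (q i) \<le> gain S i x u)}"

definition admissible_phi :: "(real \<Rightarrow> real \<Rightarrow> real) \<Rightarrow> bool" where
  "admissible_phi f \<longleftrightarrow>
    (\<forall>s\<ge>0. \<forall>t\<ge>0. 0 \<le> f s t) \<and>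
    convex_on ({0..} \<times> {0..}) (\<lambda>(s, t). f s t) \<and>
    (\<forall>s s' t t'. 0 \<le> s \<longrightarrow> s \<le> s' \<longrightarrow> 0 \<le> t \<longrightarrow> t \<le> t' \<longrightarrow> f s t \<le> f s' t')"

definition fRCI :: "('n::finite,'m::finite,'d::finite,'w::finite,'r::finite,'f::finite,'h::finite) ucs
    \<Rightarrow> (real^'n) set \<Rightarrow> bool" where
  "fRCI S I \<longleftrightarrow> compact I \<and> convex I \<and>
    I = {x \<in> state_set S. \<exists>u \<in> input_set S. \<forall>p \<in> P_set S x u.
           Amat S *v x + Bmat S *v u + Dmat S *v p \<in> I}"


section \<open>The robust MPC problem\<close>

text \<open>Elements of \<open>(\<real>\<^sup>n)\<^sup>N\<close> are lists of length \<open>N\<close>.\<close>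

definition convex_cost :: "nat \<Rightarrow> ((real^'n) list \<Rightarrow> (real^'m) list \<Rightarrow> real) \<Rightarrow> bool" where
  "convex_cost N J \<longleftrightarrow>
    (\<forall>xs ys us vs a b. length xs = N \<longrightarrow> length ys = N \<longrightarrow> length us = N \<longrightarrow> length vs = N \<longrightarrow>
       0 \<le> a \<longrightarrow> 0 \<le> b \<longrightarrow> a + b = 1 \<longrightarrow>
       J (map2 (\<lambda>x y. a *\<^sub>R x + b *\<^sub>R y) xs ys) (map2 (\<lambda>u v. a *\<^sub>R u + b *\<^sub>R v) us vs)
         \<le> a * J xs us + b * J ys vs)"

definition nominal_state :: "('n::finite,'m::finite,'d::finite,'w::finite,'r::finite,'f::finite,'h::finite) ucs
    \<Rightarrow> real^'n \<Rightarrow> (real^'m) list \<Rightarrow> nat \<Rightarrow> real^'n" where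
  "nominal_state S x us t =
    mpow (Amat S) t *v x + (\<Sum>i<t. (mpow (Amat S) (t - 1 - i) ** Bmat S) *v (us ! i))"

definition mpc_constraint :: "('n::finite,'m::finite,'d::finite,'w::finite,'r::finite,'f::finite,'h::finite) ucs
    \<Rightarrow> real^'n^'g \<Rightarrow> real^'g \<Rightarrow> real^'n \<Rightarrow> (real^'m) list \<Rightarrow> 'g \<Rightarrow> nat \<Rightarrow> bool" where
  "mpc_constraint S G g x us j t \<longleftrightarrow>
    (let DA = (\<lambda>i. mpow (Amat S) (t - 1 - i) ** Dmat S) in
       G $ j \<bullet> nominal_state S x us t
       + (\<Sum>i<t. support_fun ((\<lambda>z. DA i *v z) ` W_set S) (G $ j))
       + (\<Sum>i<t. \<Sum>l<nq S.
            pnorm (dual_exponent (pq S l)) (map (\<lambda>c. G $ j \<bullet> (DA i *v c)) (Lcols S l))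
            * gain S l (nominal_state S x us i) (us ! i))
       \<le> g $ j)"

record 'z opt_problem =
  objective :: "'z \<Rightarrow> real"
  constraint_set :: "'z set"

definition feasible :: "'z opt_problem \<Rightarrow> bool" where
  "feasible Q \<longleftrightarrow> constraint_set Q \<noteq> {}"

definition MPC :: "('n::finite,'m::finite,'d::finite,'w::finite,'r::finite,'f::finite,'h::finite) ucs
    \<Rightarrow> real^'n^'g \<Rightarrow> real^'g \<Rightarrow> ((real^'n) list \<Rightarrow> (real^'m) list \<Rightarrow> real) \<Rightarrow> nat \<Rightarrow> real^'n
    \<Rightarrow> (real^'m) list opt_problem" where
  "MPC S G g J N x =
    \<lparr>objective = (\<lambda>us. J (map (nominal_state S x us) [1..<N + 1]) us),
     constraint_set = {us. length us = N \<and> set us \<subseteq> input_set S \<and>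
       (\<forall>j. \<forall>t\<in>{1..N}. mpc_constraint S G g x us j t)}\<rparr>"

end

theory Submission
  imports Defs
begin

text \<open>
  The constraint of the MPC problem at time \<open>1\<close> is a robust counterpart: it holds at a state \<open>x\<close> and an
  input \<open>u\<close> exactly when every \<open>p \<in> P(x, u)\<close> leads to a successor in the target polytope. The reason
  is that its uncertainty terms add up to the support function of \<open>D P(x, u)\<close>: the summand \<open>W w\<close> gives
  the support function of \<open>D W\<close>, and maximising a linear form \<open>c\<close> over the ball
  \<open>\<parallel>q\<^sub>l\<parallel> \<le> \<phi>\<^sub>l\<close> gives \<open>\<phi>\<^sub>l\<close> times the dual norm of \<open>c\<close>. One inequality is Hoelder's, the other
  says that Hoelder's inequality is attained (\<open>P_set_inner_le_iff\<close>, \<open>mpc_constraint_1_iff\<close>).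

  For necessity, with \<open>N = 1\<close>, the input that invariance provides at a vertex is therefore feasible.

  For sufficiency, only the first input of a feasible sequence matters. The left hand side of the
  constraint is jointly convex in \<open>(x, u)\<close>, because a norm is convex and \<open>\<phi>\<^sub>l\<close> is convex and
  non-decreasing; hence the states that admit a feasible first input form a convex set
  (\<open>convex_mpc_1_domain\<close>). It contains the vertices of \<open>I\<close>, so by the theorem of Krein, Milman and
  Minkowski it contains \<open>I\<close>. By the robust counterpart, each state of \<open>I\<close> then has an input which
  keeps the successor in \<open>I\<close>; the converse inclusion in the definition of \<open>fRCI\<close> is trivial since
  \<open>I\<close> is the whole state constraint set.
\<close>

section \<open>Duality of the norms\<close>

lemma dual_exponent_involution:
  assumes "1 \<le> p"
  shows "dual_exponent (dual_exponent p) = p"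
proof -
  have "1 / p + 1 / dual_exponent p = 1"
    using dual_exponent[OF assms] by (simp add: add.commute)
  moreover have "1 / dual_exponent p \<noteq> top"
    using calculation by auto
  ultimately have "1 - 1 / dual_exponent p = 1 / p"
    by (metis ennreal_add_diff_cancel_right)
  then show ?thesis
    unfolding dual_exponent_def[of "dual_exponent p"] by simp
qed

lemma dual_exponent_ge_1: "1 \<le> dual_exponent p"
proof -
  have le: "1 - 1 / p \<le> 1"
    by (simp add: diff_le_self_ennreal)
  show ?thesis
  proof (cases "1 - 1 / p")
    case (real t)
    show ?thesis
    proof (cases "t = 0")
      case False
      then have "0 < t" "t \<le> 1" using real le by auto
      then have "1 \<le> 1 / t" by simp
      then show ?thesis
        using real \<open>0 < t\<close> divide_ennreal[of 1 t] by (simp add: dual_exponent_def)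
    qed (use real in \<open>simp add: dual_exponent_def\<close>)
  qed (use le in \<open>simp add: top_unique\<close>)
qed

text \<open>
  The three shapes of a conjugate pair. The norm of exponent \<open>\<infinity>\<close> is a maximum and not a power sum, so
  the facts on norms are proved separately for each shape.
\<close>

lemma dual_exponent_cases:
  assumes "1 \<le> p"
  obtains (one) "p = 1" "dual_exponent p = \<infinity>"
    | (infinity) "p = \<infinity>" "dual_exponent p = 1"
    | (finite) r s where "1 < r" "1 < s" "1 / r + 1 / s = 1"
        "p = ennreal r" "dual_exponent p = ennreal s"
proof (cases p)
  case (real r)
  then have r1: "1 \<le> r"
    using assms by (simp add: ennreal_1[symmetric] del: ennreal_1)
  show thesis
  proof (cases "r = 1")
    case True
    then show thesis using one real by (simp add: dual_exponent_def)
  next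
    case False
    then have r: "1 < r" using r1 by simp
    have inv: "1 / p = ennreal (1 / r)"
      using real r divide_ennreal[of 1 r] by simp
    have "1 - 1 / p = ennreal (1 - 1 / r)"
      unfolding inv using r by (metis divide_nonneg_nonneg ennreal_1 ennreal_minus less_eq_real_def zero_le_one real(1))
    moreover have "0 < 1 - 1 / r" using r by simp
    ultimately have dual: "dual_exponent p = ennreal (1 / (1 - 1 / r))"
      unfolding dual_exponent_def using divide_ennreal[of 1 "1 - 1 / r"] by simp
    show thesis
      by (rule finite[OF r _ _ real(2) dual]) (use r in \<open>auto simp: field_simps\<close>)
  qed
next
  case top
  then show thesis using infinity by (simp add: dual_exponent_def)
qed

lemma pnorm_finite:
  assumes "0 < r"
  shows "pnorm (ennreal r) v = (\<Sum>i<length v. \<bar>v ! i\<bar> powr r) powr (1 / r)"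
  using assms by (simp add: pnorm_def sum_list_sum_nth atLeast0LessThan)

lemma pnorm_1: "pnorm 1 v = (\<Sum>i<length v. \<bar>v ! i\<bar>)"
  using pnorm_finite[of 1 v] by (simp add: sum_nonneg)

lemma pnorm_infinity_ge: "i < length v \<Longrightarrow> \<bar>v ! i\<bar> \<le> pnorm \<infinity> v"
  by (auto simp: pnorm_def intro!: Max_ge)

lemma pnorm_nonneg: "0 \<le> pnorm p v"
  by (auto simp: pnorm_def intro!: Max_ge)

lemma pnorm_infinity_le:
  assumes "0 \<le> b" "\<And>i. i < length v \<Longrightarrow> \<bar>v ! i\<bar> \<le> b"
  shows "pnorm \<infinity> v \<le> b"
  using assms by (auto simp: pnorm_def in_set_conv_nth)

lemma pnorm_infinity_attained:
  "pnorm \<infinity> v = 0 \<or> (\<exists>i<length v. pnorm \<infinity> v = \<bar>v ! i\<bar>)"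
proof -
  have "pnorm \<infinity> v \<in> insert 0 (abs ` set v)"
    unfolding pnorm_def by (simp only: if_True simp_thms, rule Max_in) auto
  then show ?thesis by (auto simp: in_set_conv_nth)
qed

lemma pnorm_scale:
  assumes "1 \<le> p"
  shows "pnorm p (map ((*) c) v) = \<bar>c\<bar> * pnorm p v"
  using assms
proof (cases rule: dual_exponent_cases)
  case one
  then show ?thesis by (simp add: pnorm_1 abs_mult sum_distrib_left)
next
  case infinity
  show ?thesis unfolding infinity(1)
  proof (rule antisym)
    show "pnorm \<infinity> (map ((*) c) v) \<le> \<bar>c\<bar> * pnorm \<infinity> v"
      by (rule pnorm_infinity_le)
        (auto simp: pnorm_nonneg abs_mult simp del: infinity_ennreal_def
          intro!: mult_left_mono pnorm_infinity_ge)
    show "\<bar>c\<bar> * pnorm \<infinity> v \<le> pnorm \<infinity> (map ((*) c) v)"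
      using pnorm_infinity_attained[of v] pnorm_infinity_ge[of _ "map ((*) c) v"]
      by (auto simp: pnorm_nonneg abs_mult)
  qed
next
  case (finite r s)
  then show ?thesis
    by (simp add: pnorm_finite abs_mult powr_mult sum_distrib_left[symmetric] powr_powr sum_nonneg)
qed

lemma pnorm_zero: "1 \<le> p \<Longrightarrow> pnorm p (replicate n 0) = 0"
  using pnorm_scale[of p 0 "replicate n 0"] by (simp add: map_replicate)

text \<open>
  Young's inequality, applied to the entries after both vectors are scaled to norm \<open>1\<close>, and summed.
\<close>

lemma Holder_sum:
  fixes x y :: "'i \<Rightarrow> real"
  assumes "1 < r" "1 < s" "1 / r + 1 / s = 1" "finite I"
  shows "(\<Sum>i\<in>I. x i * y i) \<le> (\<Sum>i\<in>I. \<bar>x i\<bar> powr r) powr (1 / r) * (\<Sum>i\<in>I. \<bar>y i\<bar> powr s) powr (1 / s)"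
proof -
  define X where "X = (\<Sum>i\<in>I. \<bar>x i\<bar> powr r)"
  define Y where "Y = (\<Sum>i\<in>I. \<bar>y i\<bar> powr s)"
  have nn: "0 \<le> X" "0 \<le> Y" by (auto simp: X_def Y_def intro!: sum_nonneg)
  show ?thesis
  proof (cases "X = 0 \<or> Y = 0")
    case True
    then have "\<forall>i\<in>I. x i * y i = 0"
      using assms by (auto simp: X_def Y_def sum_nonneg_eq_0_iff)
    then have "(\<Sum>i\<in>I. x i * y i) = 0" by (intro sum.neutral) auto
    then show ?thesis by simp
  next
    case False
    then have pos: "0 < X" "0 < Y" using nn by auto
    define a where "a = X powr (1 / r)"
    define b where "b = Y powr (1 / s)"
    have ab: "0 < a" "0 < b" using pos by (auto simp: a_def b_def)
    have pw: "a powr r = X" "b powr s = Y"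
      using assms pos by (auto simp: a_def b_def powr_powr)
    have "(\<Sum>i\<in>I. x i * y i) / (a * b) = (\<Sum>i\<in>I. (x i / a) * (y i / b))"
      by (simp add: sum_divide_distrib)
    also have "\<dots> \<le> (\<Sum>i\<in>I. (\<bar>x i\<bar> powr r / X) / r + (\<bar>y i\<bar> powr s / Y) / s)"
    proof (rule sum_mono)
      fix i
      have "(x i / a) * (y i / b) \<le> (\<bar>x i\<bar> / a) * (\<bar>y i\<bar> / b)"
        using ab abs_ge_self[of "(x i / a) * (y i / b)"] by (simp add: abs_mult)
      also have "\<dots> \<le> (\<bar>x i\<bar> / a) powr r / r + (\<bar>y i\<bar> / b) powr s / s"
        using assms ab by (intro Youngs_inequality) auto
      finally show "(x i / a) * (y i / b) \<le> (\<bar>x i\<bar> powr r / X) / r + (\<bar>y i\<bar> powr s / Y) / s"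
        using ab by (simp add: powr_divide pw)
    qed
    also have "\<dots> = (X / X) / r + (Y / Y) / s"
      by (simp add: sum.distrib sum_divide_distrib[symmetric] X_def Y_def)
    also have "\<dots> = 1" using pos assms by simp
    finally show ?thesis
      using ab by (simp add: a_def[symmetric] b_def[symmetric] X_def[symmetric] Y_def[symmetric] pos_divide_le_eq)
  qed
qed

lemma pnorm_Holder:
  assumes "1 \<le> p" "length x = n" "length y = n"
  shows "(\<Sum>i<n. x ! i * y ! i) \<le> pnorm p x * pnorm (dual_exponent p) y"
  using assms(1)
proof (cases rule: dual_exponent_cases)
  case one
  have "x ! i * y ! i \<le> \<bar>x ! i\<bar> * pnorm \<infinity> y" if "i < n" for i
    using mult_left_mono[OF pnorm_infinity_ge[of i y], of "\<bar>x ! i\<bar>"]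
      abs_ge_self[of "x ! i * y ! i"] that assms by (simp add: abs_mult)
  then have "(\<Sum>i<n. x ! i * y ! i) \<le> (\<Sum>i<n. \<bar>x ! i\<bar> * pnorm \<infinity> y)"
    by (intro sum_mono) simp
  then show ?thesis using one assms by (simp add: pnorm_1 sum_distrib_right)
next
  case infinity
  have "x ! i * y ! i \<le> pnorm \<infinity> x * \<bar>y ! i\<bar>" if "i < n" for i
    using mult_right_mono[OF pnorm_infinity_ge[of i x], of "\<bar>y ! i\<bar>"]
      abs_ge_self[of "x ! i * y ! i"] that assms by (simp add: abs_mult)
  then have "(\<Sum>i<n. x ! i * y ! i) \<le> (\<Sum>i<n. pnorm \<infinity> x * \<bar>y ! i\<bar>)"
    by (intro sum_mono) simp
  then show ?thesis using infinity assms by (simp add: pnorm_1 sum_distrib_left)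
next
  case (finite r s)
  then show ?thesis
    using Holder_sum[of r s "{..<n}" "(!) x" "(!) y"] assms by (simp add: pnorm_finite)
qed

text \<open>
  The extremal vector has the signs of \<open>y\<close>. For exponent \<open>1\<close> it is concentrated at one entry of
  maximal modulus, for exponent \<open>\<infinity>\<close> it has all moduli equal to \<open>1\<close>, and for a finite \<open>r > 1\<close> its moduli
  are proportional to \<open>\<bar>y\<^sub>i\<bar> powr (s - 1)\<close>, where \<open>s\<close> is conjugate to \<open>r\<close>.
\<close>

lemma pnorm_Holder_attained:
  assumes "1 \<le> p"
  obtains x where "length x = length y" "pnorm p x \<le> 1"
    "(\<Sum>i<length y. x ! i * y ! i) = pnorm (dual_exponent p) y"
proof (cases "pnorm (dual_exponent p) y = 0")
  case True
  show thesis
    using True assms that[of "replicate (length y) 0"] by (simp add: pnorm_zero)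
next
  case nz: False
  show thesis
    using assms
  proof (cases rule: dual_exponent_cases)
    case one
    then obtain k where k: "k < length y" "pnorm \<infinity> y = \<bar>y ! k\<bar>"
      using pnorm_infinity_attained[of y] nz by auto
    define x where "x = (replicate (length y) 0)[k := sgn (y ! k)]"
    have x: "x ! i = (if i = k then sgn (y ! k) else 0)" if "i < length y" for i
      using that k by (simp add: x_def nth_list_update)
    have "(\<Sum>i<length y. x ! i * y ! i) = (\<Sum>i<length y. if i = k then sgn (y ! k) * y ! k else 0)"
      by (rule sum.cong) (auto simp: x)
    then have 1: "(\<Sum>i<length y. x ! i * y ! i) = \<bar>y ! k\<bar>"
      using k by (simp add: abs_sgn mult.commute)
    have "(\<Sum>i<length y. \<bar>x ! i\<bar>) = (\<Sum>i<length y. if i = k then \<bar>sgn (y ! k)\<bar> else 0)"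
      by (rule sum.cong) (auto simp: x)
    then have "pnorm 1 x \<le> 1"
      using k by (simp add: pnorm_1 x_def sgn_if)
    then show thesis
      using that[of x] one k 1 by (simp add: x_def)
  next
    case infinity
    have "pnorm \<infinity> (map sgn y) \<le> 1"
      by (rule pnorm_infinity_le) (auto simp: sgn_if)
    moreover have "(\<Sum>i<length y. map sgn y ! i * y ! i) = pnorm 1 y"
      unfolding pnorm_1 by (rule sum.cong) (auto simp: abs_sgn mult.commute)
    ultimately show thesis
      using that[of "map sgn y"] infinity by simp
  next
    case (finite r s)
    define Y where "Y = (\<Sum>i<length y. \<bar>y ! i\<bar> powr s)"
    have Yn: "pnorm (dual_exponent p) y = Y powr (1 / s)"
      using finite by (simp add: pnorm_finite Y_def)
    have "0 \<le> Y" by (auto simp: Y_def intro!: sum_nonneg)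
    then have Y: "0 < Y" using nz Yn by (cases "Y = 0") auto
    define x where "x = map (\<lambda>t. sgn t * \<bar>t\<bar> powr (s - 1) / Y powr (1 / r)) y"
    \<comment> \<open>Conjugacy makes the \<open>r\<close>-th powers of the entries of \<open>x\<close> proportional to \<open>\<bar>y\<^sub>i\<bar> powr s\<close>.\<close>
    have rs: "(s - 1) * r = s" using finite by (simp add: field_simps)
    have pt: "sgn t * \<bar>t\<bar> powr (s - 1) * t = \<bar>t\<bar> powr s" for t :: real
    proof (cases "t = 0")
      case False
      have "sgn t * \<bar>t\<bar> powr (s - 1) * t = \<bar>t\<bar> powr (s - 1) * \<bar>t\<bar> powr 1"
        using False by (simp add: sgn_if)
      also have "\<dots> = \<bar>t\<bar> powr s" by (subst powr_add[symmetric]) simp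
      finally show ?thesis .
    qed simp
    have "(\<Sum>i<length y. x ! i * y ! i) = (\<Sum>i<length y. \<bar>y ! i\<bar> powr s / Y powr (1 / r))"
      by (rule sum.cong) (auto simp: x_def pt)
    also have "\<dots> = Y powr 1 / Y powr (1 / r)"
      using Y by (simp add: sum_divide_distrib[symmetric] Y_def)
    also have "\<dots> = Y powr (1 / s)"
    proof -
      have "1 - 1 / r = 1 / s" using finite by simp
      then show ?thesis by (simp only: powr_diff[symmetric])
    qed
    finally have 1: "(\<Sum>i<length y. x ! i * y ! i) = pnorm (dual_exponent p) y"
      unfolding Yn .
    have "\<bar>x ! i\<bar> powr r = \<bar>y ! i\<bar> powr s / Y" if "i < length y" for i
    proof (cases "y ! i = 0")
      case False
      then have "\<bar>x ! i\<bar> = \<bar>y ! i\<bar> powr (s - 1) / Y powr (1 / r)"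
        using that by (simp add: x_def abs_mult)
      then show ?thesis
        using Y finite by (simp add: powr_divide powr_powr rs)
    qed (use that in \<open>simp add: x_def\<close>)
    then have "(\<Sum>i<length y. \<bar>x ! i\<bar> powr r) = (\<Sum>i<length y. \<bar>y ! i\<bar> powr s / Y)"
      by (intro sum.cong) auto
    also have "\<dots> = 1"
      using Y by (simp add: sum_divide_distrib[symmetric] Y_def)
    finally have "pnorm p x \<le> 1"
      using finite by (simp add: pnorm_finite x_def)
    then show thesis using that[of x] 1 by (simp add: x_def)
  qed
qed

text \<open>
  Minkowski's inequality by duality: the norm of exponent \<open>p\<close> is a maximum of linear forms, namely the
  forms given by the unit ball of the dual norm.
\<close>

lemma pnorm_triangle:
  assumes "1 \<le> p" "length x = n" "length y = n"
  shows "pnorm p (map2 (+) x y) \<le> pnorm p x + pnorm p y"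
proof -
  let ?q = "dual_exponent p"
  obtain z where z: "length z = n" "pnorm ?q z \<le> 1"
    "(\<Sum>i<n. z ! i * map2 (+) x y ! i) = pnorm p (map2 (+) x y)"
    using pnorm_Holder_attained[OF dual_exponent_ge_1, of "map2 (+) x y" p] assms
    by (auto simp: dual_exponent_involution)
  have le: "(\<Sum>i<n. z ! i * v ! i) \<le> pnorm p v" if "length v = n" for v
  proof -
    have "(\<Sum>i<n. z ! i * v ! i) \<le> pnorm ?q z * pnorm p v"
      using pnorm_Holder[OF dual_exponent_ge_1 z(1) that, of p] assms
      by (simp add: dual_exponent_involution)
    also have "\<dots> \<le> 1 * pnorm p v"
      by (intro mult_right_mono z pnorm_nonneg)
    finally show ?thesis by simp
  qed
  have "pnorm p (map2 (+) x y) = (\<Sum>i<n. z ! i * x ! i) + (\<Sum>i<n. z ! i * y ! i)"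
    unfolding z(3)[symmetric] sum.distrib[symmetric]
    by (rule sum.cong) (use assms in \<open>auto simp: distrib_left\<close>)
  then show ?thesis using le[OF assms(2)] le[OF assms(3)] by simp
qed

lemma pnorm_rows_mult_convex:
  assumes "1 \<le> p" "0 \<le> a" "0 \<le> b"
  shows "pnorm p (rows_mult rs (a *\<^sub>R x + b *\<^sub>R y))
    \<le> a * pnorm p (rows_mult rs x) + b * pnorm p (rows_mult rs y)"
proof -
  have "rows_mult rs (a *\<^sub>R x + b *\<^sub>R y)
      = map2 (+) (map ((*) a) (rows_mult rs x)) (map ((*) b) (rows_mult rs y))"
    by (rule nth_equalityI) (auto simp: rows_mult_def inner_add_right)
  then have "pnorm p (rows_mult rs (a *\<^sub>R x + b *\<^sub>R y))
      \<le> pnorm p (map ((*) a) (rows_mult rs x)) + pnorm p (map ((*) b) (rows_mult rs y))"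
    using pnorm_triangle[OF assms(1)] by (simp only: length_map rows_mult_def)
  also have "\<dots> = a * pnorm p (rows_mult rs x) + b * pnorm p (rows_mult rs y)"
    using assms by (simp only: pnorm_scale abs_of_nonneg)
  finally show ?thesis .
qed


section \<open>The one-step constraint\<close>

lemma inner_cols_mult:
  fixes M :: "real^'d::finite^'n::finite"
  assumes "length q = length cs"
  shows "y \<bullet> (M *v cols_mult cs q) = (\<Sum>i<length cs. q ! i * map (\<lambda>c. y \<bullet> (M *v c)) cs ! i)"
proof -
  have "cols_mult cs q = (\<Sum>i<length cs. (q ! i) *\<^sub>R (cs ! i))"
    using assms by (simp add: cols_mult_def sum_list_sum_nth atLeast0LessThan)
  then show ?thesis
    by (simp add: linear_sum[OF matrix_vector_mul_linear] inner_sum_right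
        matrix_vector_mult_scaleR)
qed

lemma gain_nonneg:
  assumes "admissible_phi (phi S l)"
  shows "0 \<le> gain S l x u"
  using assms pnorm_nonneg unfolding admissible_phi_def gain_def by blast

text \<open>
  Monotonicity of \<open>\<phi>\<^sub>l\<close> is what makes its composition with the two convex norms convex.
\<close>

lemma gain_convex:
  assumes "admissible_phi (phi S l)" "1 \<le> px S l" "1 \<le> pu S l"
    and "0 \<le> a" "0 \<le> b" "a + b = 1"
  shows "gain S l (a *\<^sub>R x + b *\<^sub>R y) (a *\<^sub>R u + b *\<^sub>R v) \<le> a * gain S l x u + b * gain S l y v"
proof -
  define X where "X = (\<lambda>x. pnorm (px S l) (rows_mult (Fxrows S l) x))"
  define U where "U = (\<lambda>u. pnorm (pu S l) (rows_mult (Furows S l) u))"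
  have nn: "0 \<le> X z" "0 \<le> U w" for z w by (auto simp: X_def U_def pnorm_nonneg)
  have "phi S l (X (a *\<^sub>R x + b *\<^sub>R y)) (U (a *\<^sub>R u + b *\<^sub>R v))
      \<le> phi S l (a * X x + b * X y) (a * U u + b * U v)"
  proof -
    have "X (a *\<^sub>R x + b *\<^sub>R y) \<le> a * X x + b * X y" "U (a *\<^sub>R u + b *\<^sub>R v) \<le> a * U u + b * U v"
      unfolding X_def U_def using assms by (auto intro!: pnorm_rows_mult_convex)
    with assms(1) nn show ?thesis by (simp add: admissible_phi_def)
  qed
  also have "\<dots> \<le> a * phi S l (X x) (U u) + b * phi S l (X y) (U v)"
  proof -
    have "convex_on ({0..} \<times> {0..}) (\<lambda>(s, t). phi S l s t)"
      using assms(1) by (simp add: admissible_phi_def)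
    from this[unfolded convex_on_def, THEN conjunct2, rule_format, of "(X x, U u)" "(X y, U v)" a b]
    show ?thesis using assms nn by simp
  qed
  finally show ?thesis by (simp add: gain_def X_def U_def)
qed

text \<open>
  All \<open>q\<^sub>l\<close> can be taken to be \<open>0\<close>. Hence boundedness passes from \<open>P(x, u)\<close> to \<open>W\<close>, which makes the
  supremum in the support function of \<open>W\<close> meaningful.
\<close>

lemma W_set_subset_P_set:
  fixes S :: "('n::finite, 'm::finite, 'd::finite, 'w::finite, 'r::finite, 'f::finite, 'h::finite) ucs"
  assumes "\<And>l. l < nq S \<Longrightarrow> 1 \<le> pq S l" "\<And>l. l < nq S \<Longrightarrow> admissible_phi (phi S l)"
  shows "W_set S \<subseteq> P_set S x u"
proof
  fix z assume "z \<in> W_set S"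
  then obtain w where w: "z = Wmat S *v w" "Rmat S *v w \<le> rvec S"
    by (auto simp: W_set_def)
  have "cols_mult cs (replicate (length cs) 0) = 0" for cs :: "(real^'d) list"
    by (simp add: cols_mult_def sum_list_sum_nth)
  then have "z = Wmat S *v w + (\<Sum>l<nq S. cols_mult (Lcols S l) (replicate (length (Lcols S l)) 0))"
    using w by simp
  moreover have "pnorm (pq S l) (replicate (length (Lcols S l)) 0) \<le> gain S l x u" if "l < nq S" for l
    using that assms by (simp add: pnorm_zero gain_nonneg)
  ultimately show "z \<in> P_set S x u"
    unfolding P_set_def using w(2)
    by (intro CollectI exI[of _ w] exI[of _ "\<lambda>l. replicate (length (Lcols S l)) 0"]) simp
qed

text \<open>
  The support function of \<open>M P(x, u)\<close>, stated as a bound. The choices of \<open>w\<close> and of the \<open>q\<^sub>l\<close> are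
  independent, so the maximum of the linear form is the sum of the separate maxima.
\<close>

lemma P_set_inner_le_iff:
  fixes S :: "('n::finite, 'm::finite, 'd::finite, 'w::finite, 'r::finite, 'f::finite, 'h::finite) ucs"
    and M :: "real^'d^'k::finite"
  assumes pq: "\<And>l. l < nq S \<Longrightarrow> 1 \<le> pq S l"
    and phi: "\<And>l. l < nq S \<Longrightarrow> admissible_phi (phi S l)"
    and ne: "P_set S x u \<noteq> {}" and bd: "bounded (P_set S x u)"
  shows "(\<forall>p\<in>P_set S x u. y \<bullet> (M *v p) \<le> b) \<longleftrightarrow>
    support_fun ((*v) M ` W_set S) y
      + (\<Sum>l<nq S. pnorm (dual_exponent (pq S l)) (map (\<lambda>c. y \<bullet> (M *v c)) (Lcols S l)) * gain S l x u)
    \<le> b"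
proof -
  define C where "C l = map (\<lambda>c. y \<bullet> (M *v c)) (Lcols S l)" for l
  define E where "E l = pnorm (dual_exponent (pq S l)) (C l) * gain S l x u" for l
  have split: "y \<bullet> (M *v (z + (\<Sum>l<nq S. cols_mult (Lcols S l) (q l))))
      = y \<bullet> (M *v z) + (\<Sum>l<nq S. \<Sum>i<length (Lcols S l). q l ! i * C l ! i)"
    if "\<forall>l<nq S. length (q l) = length (Lcols S l)" for z q
    using that
    by (simp add: matrix_vector_right_distrib linear_sum[OF matrix_vector_mul_linear]
        inner_add_right inner_sum_right inner_cols_mult C_def)
  have Wne: "W_set S \<noteq> {}"
    using ne by (auto simp: W_set_def P_set_def)
  have "bounded ((*v) M ` W_set S)"
    using bounded_subset[OF bd W_set_subset_P_set] pq phi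
    by (intro bounded_linear_image matrix_vector_mul_bounded_linear) auto
  then have bdd: "bdd_above ((\<bullet>) y ` (*v) M ` W_set S)"
    by (intro bounded_imp_bdd_above bounded_linear_image[OF _ bounded_linear_inner_right])
  have "(\<forall>p\<in>P_set S x u. y \<bullet> (M *v p) \<le> b) \<longleftrightarrow>
      (\<forall>z\<in>W_set S. y \<bullet> (M *v z) + (\<Sum>l<nq S. E l) \<le> b)"
  proof safe
    fix z assume le: "\<forall>p\<in>P_set S x u. y \<bullet> (M *v p) \<le> b" and "z \<in> W_set S"
    then obtain w where w: "z = Wmat S *v w" "Rmat S *v w \<le> rvec S"
      by (auto simp: W_set_def)
    have "\<forall>l\<in>{..<nq S}. \<exists>q. length q = length (C l) \<and> pnorm (pq S l) q \<le> 1 \<and>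
        (\<Sum>i<length (C l). q ! i * C l ! i) = pnorm (dual_exponent (pq S l)) (C l)"
      by (metis pnorm_Holder_attained pq lessThan_iff)
    from bchoice[OF this] obtain q where q: "\<And>l. l < nq S \<Longrightarrow> length (q l) = length (Lcols S l)"
        "\<And>l. l < nq S \<Longrightarrow> pnorm (pq S l) (q l) \<le> 1"
        "\<And>l. l < nq S \<Longrightarrow> (\<Sum>i<length (Lcols S l). q l ! i * C l ! i) = pnorm (dual_exponent (pq S l)) (C l)"
      by (auto simp: C_def)
    \<comment> \<open>The worst case: each \<open>q\<^sub>l\<close> attains equality in Hoelder's inequality on the ball of radius \<open>\<phi>\<^sub>l\<close>.\<close>
    define Q where "Q l = map ((*) (gain S l x u)) (q l)" for l
    have len: "\<forall>l<nq S. length (Q l) = length (Lcols S l)" by (simp add: Q_def q)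
    have "pnorm (pq S l) (Q l) \<le> gain S l x u" if "l < nq S" for l
      using that mult_left_mono[OF q(2)[OF that] gain_nonneg[OF phi[OF that], of x u]]
      by (simp add: Q_def pnorm_scale pq gain_nonneg phi)
    with len w have "z + (\<Sum>l<nq S. cols_mult (Lcols S l) (Q l)) \<in> P_set S x u"
      unfolding P_set_def by blast
    with le have "y \<bullet> (M *v z) + (\<Sum>l<nq S. \<Sum>i<length (Lcols S l). Q l ! i * C l ! i) \<le> b"
      by (simp add: split[OF len, symmetric])
    moreover have "(\<Sum>i<length (Lcols S l). Q l ! i * C l ! i) = E l" if "l < nq S" for l
    proof -
      have "(\<Sum>i<length (Lcols S l). Q l ! i * C l ! i)
          = (\<Sum>i<length (Lcols S l). gain S l x u * (q l ! i * C l ! i))"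
        by (rule sum.cong) (auto simp: Q_def q that)
      then show ?thesis by (simp add: sum_distrib_left[symmetric] q that E_def)
    qed
    ultimately show "y \<bullet> (M *v z) + (\<Sum>l<nq S. E l) \<le> b" by simp
  next
    fix p assume le: "\<forall>z\<in>W_set S. y \<bullet> (M *v z) + (\<Sum>l<nq S. E l) \<le> b" and "p \<in> P_set S x u"
    then obtain w q where p: "p = Wmat S *v w + (\<Sum>l<nq S. cols_mult (Lcols S l) (q l))"
        "Rmat S *v w \<le> rvec S"
        and len: "\<forall>l<nq S. length (q l) = length (Lcols S l)"
        and q: "\<forall>l<nq S. pnorm (pq S l) (q l) \<le> gain S l x u"
      unfolding P_set_def by blast
    have "(\<Sum>i<length (Lcols S l). q l ! i * C l ! i) \<le> E l" if l: "l < nq S" for l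
    proof -
      have "(\<Sum>i<length (Lcols S l). q l ! i * C l ! i)
          \<le> pnorm (pq S l) (q l) * pnorm (dual_exponent (pq S l)) (C l)"
        using len l by (intro pnorm_Holder pq) (auto simp: C_def)
      also have "\<dots> \<le> gain S l x u * pnorm (dual_exponent (pq S l)) (C l)"
        using q l by (intro mult_right_mono pnorm_nonneg) auto
      finally show ?thesis by (simp add: E_def mult.commute)
    qed
    then have "y \<bullet> (M *v p) \<le> y \<bullet> (M *v (Wmat S *v w)) + (\<Sum>l<nq S. E l)"
      unfolding p split[OF len] by (intro add_left_mono sum_mono) simp
    also have "\<dots> \<le> b" using le p by (auto simp: W_set_def)
    finally show "y \<bullet> (M *v p) \<le> b" .
  qed
  also have "\<dots> \<longleftrightarrow> (\<forall>z\<in>(*v) M ` W_set S. y \<bullet> z \<le> b - (\<Sum>l<nq S. E l))"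
    by (auto simp: algebra_simps)
  also have "\<dots> \<longleftrightarrow> support_fun ((*v) M ` W_set S) y \<le> b - (\<Sum>l<nq S. E l)"
    unfolding support_fun_def using Wne bdd by (subst cSUP_le_iff) auto
  finally show ?thesis by (auto simp: E_def C_def algebra_simps)
qed

lemma mpow_0: "mpow A 0 = mat 1"
  by (simp add: mpow_def)

lemma mpow_1: "mpow A 1 = A"
  by (simp add: mpow_def)

lemma mpc_constraint_1:
  "mpc_constraint S G g x us j 1 \<longleftrightarrow>
    G $ j \<bullet> (Amat S *v x + Bmat S *v (us ! 0))
    + support_fun ((*v) (Dmat S) ` W_set S) (G $ j)
    + (\<Sum>l<nq S. pnorm (dual_exponent (pq S l)) (map (\<lambda>c. G $ j \<bullet> (Dmat S *v c)) (Lcols S l))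
        * gain S l x (us ! 0)) \<le> g $ j"
  by (simp add: mpc_constraint_def nominal_state_def Let_def mpow_0 mpow_1[simplified])

text \<open>
  The robust counterpart: each row of \<open>G\<close> bounds a linear form of the successor state, whose maximum
  over the uncertainty was computed above.
\<close>

lemma mpc_constraint_1_iff:
  fixes S :: "('n::finite, 'm::finite, 'd::finite, 'w::finite, 'r::finite, 'f::finite, 'h::finite) ucs"
    and G :: "real^'n^'g::finite"
  assumes "\<And>l. l < nq S \<Longrightarrow> 1 \<le> pq S l"
    and "\<And>l. l < nq S \<Longrightarrow> admissible_phi (phi S l)"
    and "P_set S x (us ! 0) \<noteq> {}" and "bounded (P_set S x (us ! 0))"
  shows "(\<forall>j. mpc_constraint S G g x us j 1) \<longleftrightarrow>
    (\<forall>p\<in>P_set S x (us ! 0). Amat S *v x + Bmat S *v (us ! 0) + Dmat S *v p \<in> polyh G g)"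
proof -
  have "mpc_constraint S G g x us j 1 \<longleftrightarrow>
      (\<forall>p\<in>P_set S x (us ! 0). G $ j \<bullet> (Dmat S *v p)
        \<le> g $ j - G $ j \<bullet> (Amat S *v x + Bmat S *v (us ! 0)))" for j
    using P_set_inner_le_iff[OF assms, of "G $ j" "Dmat S"
        "g $ j - G $ j \<bullet> (Amat S *v x + Bmat S *v (us ! 0))"]
    unfolding mpc_constraint_1 by linarith
  moreover have "z \<in> polyh G g \<longleftrightarrow> (\<forall>j. G $ j \<bullet> z \<le> g $ j)" for z
    by (simp add: polyh_def less_eq_vec_def matrix_vector_mul_component)
  ultimately show ?thesis
    by (auto simp: inner_add_right algebra_simps)
qed

text \<open>
  The set is the projection to the states of a set of pairs \<open>(x, u)\<close> that is convex: for each \<open>j\<close> the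
  constraint function is affine in \<open>(x, u)\<close> apart from a combination of the gains, whose coefficients
  are norms and hence non-negative.
\<close>

lemma convex_mpc_1_domain:
  fixes G :: "real^'n::finite^'g::finite"
    and S :: "('n::finite, 'm::finite, 'd::finite, 'w::finite, 'r::finite, 'f::finite, 'h::finite) ucs"
  assumes "convex (input_set S)"
    and "\<And>l. l < nq S \<Longrightarrow> 1 \<le> px S l \<and> 1 \<le> pu S l"
    and "\<And>l. l < nq S \<Longrightarrow> admissible_phi (phi S l)"
  shows "convex {x. \<exists>u\<in>input_set S. \<forall>j. mpc_constraint S G g x [u] j 1}"
proof (rule convexI, clarsimp simp del: One_nat_def)
  fix x y u v and a b :: real
  assume ab: "0 \<le> a" "0 \<le> b" "a + b = 1" and uv: "u \<in> input_set S" "v \<in> input_set S"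
    and cx: "\<forall>j. mpc_constraint S G g x [u] j 1" and cy: "\<forall>j. mpc_constraint S G g y [v] j 1"
  have "mpc_constraint S G g (a *\<^sub>R x + b *\<^sub>R y) [a *\<^sub>R u + b *\<^sub>R v] j 1" for j
  proof -
    define \<sigma> where "\<sigma> = support_fun ((*v) (Dmat S) ` W_set S) (G $ j)"
    define e where "e l = pnorm (dual_exponent (pq S l)) (map (\<lambda>c. G $ j \<bullet> (Dmat S *v c)) (Lcols S l))" for l
    define h where "h x u = G $ j \<bullet> (Amat S *v x + Bmat S *v u)" for x u
    have "h (a *\<^sub>R x + b *\<^sub>R y) (a *\<^sub>R u + b *\<^sub>R v) = a * h x u + b * h y v"
      by (simp add: h_def matrix_vector_right_distrib matrix_vector_mult_scaleR inner_add_right algebra_simps)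
    moreover have "\<sigma> = a * \<sigma> + b * \<sigma>" using ab by (simp flip: distrib_right)
    moreover have "(\<Sum>l<nq S. e l * gain S l (a *\<^sub>R x + b *\<^sub>R y) (a *\<^sub>R u + b *\<^sub>R v))
        \<le> (\<Sum>l<nq S. e l * (a * gain S l x u + b * gain S l y v))"
      using assms ab by (intro sum_mono mult_left_mono gain_convex) (auto simp: e_def pnorm_nonneg)
    moreover have "\<dots> = a * (\<Sum>l<nq S. e l * gain S l x u) + b * (\<Sum>l<nq S. e l * gain S l y v)"
      by (simp add: sum_distrib_left sum.distrib[symmetric] algebra_simps)
    ultimately have "h (a *\<^sub>R x + b *\<^sub>R y) (a *\<^sub>R u + b *\<^sub>R v) + \<sigma>
          + (\<Sum>l<nq S. e l * gain S l (a *\<^sub>R x + b *\<^sub>R y) (a *\<^sub>R u + b *\<^sub>R v))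
        \<le> a * (h x u + \<sigma> + (\<Sum>l<nq S. e l * gain S l x u))
          + b * (h y v + \<sigma> + (\<Sum>l<nq S. e l * gain S l y v))"
      by (simp add: algebra_simps)
    also have "\<dots> \<le> g $ j"
      using cx cy ab
      by (intro convex_bound_le) (simp_all add: mpc_constraint_1 h_def \<sigma>_def e_def del: One_nat_def)
    finally show ?thesis
      by (simp add: mpc_constraint_1 h_def \<sigma>_def e_def del: One_nat_def)
  qed
  moreover have "a *\<^sub>R u + b *\<^sub>R v \<in> input_set S"
    using assms(1) uv ab by (simp add: convexD)
  ultimately show "\<exists>w\<in>input_set S. \<forall>j. mpc_constraint S G g (a *\<^sub>R x + b *\<^sub>R y) [w] j 1"
    by blast
qed


section \<open>Vertex feasibility and robust controlled invariance\<close>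

text \<open>
  Truncation to horizon \<open>1\<close>: the constraint at time \<open>1\<close> involves only the first input.
\<close>

lemma feasible_MPC_imp_one_step:
  assumes "feasible (MPC S G g J N x)" "1 \<le> N"
  obtains u where "u \<in> input_set S" "\<forall>j. mpc_constraint S G g x [u] j 1"
proof -
  obtain us where us: "length us = N" "set us \<subseteq> input_set S"
      "\<forall>j. mpc_constraint S G g x us j 1"
    using assms by (auto simp: feasible_def MPC_def)
  then have "us ! 0 \<in> input_set S" using assms(2) by (metis One_nat_def Suc_le_eq nth_mem subsetD)
  moreover have "\<forall>j. mpc_constraint S G g x [us ! 0] j 1"
    using us(3) by (simp add: mpc_constraint_1 del: One_nat_def)
  ultimately show thesis by (rule that)
qed

theorem corollary1:
  fixes S :: "('n::finite, 'm::finite, 'd::finite, 'w::finite, 'r::finite, 'f::finite, 'h::finite) ucs"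
    and J :: "(real^'n) list \<Rightarrow> (real^'m) list \<Rightarrow> real"
    and N :: nat
    and I :: "(real^'n) set"
  assumes "polytope (state_set S)"
    and "polytope (input_set S)"
    and "\<And>i. i < nq S \<Longrightarrow> 1 \<le> pq S i \<and> 1 \<le> px S i \<and> 1 \<le> pu S i"
    and "\<And>i. i < nq S \<Longrightarrow> admissible_phi (phi S i)"
    and "\<And>x u. x \<in> state_set S \<Longrightarrow> u \<in> input_set S \<Longrightarrow> P_set S x u \<noteq> {} \<and> compact (P_set S x u)"
    and "1 \<le> N"
    and "convex_cost N J"
    and "I = polyh (Fmat S) (fvec S)"
  shows "((\<forall>v. v extreme_point_of I \<longrightarrow> feasible (MPC S (Fmat S) (fvec S) J N v)) \<longrightarrow> fRCI S I) \<and>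
    (N = 1 \<longrightarrow> fRCI S I \<longrightarrow> (\<forall>v. v extreme_point_of I \<longrightarrow> feasible (MPC S (Fmat S) (fvec S) J N v)))"
proof -
  have I: "I = state_set S" "compact I" "convex I"
    using assms(1,8) by (auto simp: state_set_def polytope_imp_compact polytope_imp_convex)
  have one_step: "(\<forall>j. mpc_constraint S (Fmat S) (fvec S) x [u] j 1) \<longleftrightarrow>
      (\<forall>p\<in>P_set S x u. Amat S *v x + Bmat S *v u + Dmat S *v p \<in> I)"
    if "x \<in> I" "u \<in> input_set S" for x u
  proof -
    have "P_set S x u \<noteq> {}" "bounded (P_set S x u)"
      using assms(5)[of x u] that I(1) by (auto intro: compact_imp_bounded)
    with mpc_constraint_1_iff[of S x "[u]" "Fmat S" "fvec S"] assms(3,4)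
    show ?thesis unfolding assms(8) by simp
  qed
  show ?thesis
  proof (intro conjI impI allI)
    assume feas: "\<forall>v. v extreme_point_of I \<longrightarrow> feasible (MPC S (Fmat S) (fvec S) J N v)"
    \<comment> \<open>The states with a robustly admissible input; interpolating the inputs at the vertices covers \<open>I\<close>.\<close>
    let ?C = "{x. \<exists>u\<in>input_set S. \<forall>j. mpc_constraint S (Fmat S) (fvec S) x [u] j 1}"
    have "{v. v extreme_point_of I} \<subseteq> ?C"
      using feas feasible_MPC_imp_one_step[OF _ assms(6)] by blast
    moreover have "convex ?C"
      using assms(2-4) by (intro convex_mpc_1_domain polytope_imp_convex) auto
    ultimately have "I \<subseteq> ?C"
      by (subst Krein_Milman_Minkowski[OF I(2,3)]) (rule hull_minimal)
    then have "I = {x \<in> state_set S. \<exists>u\<in>input_set S. \<forall>p\<in>P_set S x u.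
        Amat S *v x + Bmat S *v u + Dmat S *v p \<in> I}"
      using one_step I(1) by blast
    then show "fRCI S I" using I by (simp add: fRCI_def)
  next
    fix v assume N: "N = 1" and inv: "fRCI S I" and "v extreme_point_of I"
    then have v: "v \<in> I" by (simp add: extreme_point_of_def)
    then obtain u where u: "u \<in> input_set S"
        "\<forall>p\<in>P_set S v u. Amat S *v v + Bmat S *v u + Dmat S *v p \<in> I"
      using inv unfolding fRCI_def by blast
    then have "[u] \<in> constraint_set (MPC S (Fmat S) (fvec S) J N v)"
      using one_step[OF v u(1)] N by (simp add: MPC_def)
    then show "feasible (MPC S (Fmat S) (fvec S) J N v)"
      by (auto simp: feasible_def)
  qed
qed

end
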